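(* Let $G$ be a finite group and let $N$ and $H$ be normal subgroups of $G$ such that $H$ contains $N$. Then the following hold: (i) if $H$ is a perfect code of some Cayley sum graph of $G$, then $H/N$ is a perfect code of some Cayley sum graph of $G/N$; (ii) if $N$ is a perfect code of some Cayley sum graph of $G$ and $H/N$ is a perfect code of some Cayley sum graph of $G/N$, then $H$ is a perfect code of some Cayley sum graph of $G$.
   Context: A subset $X$ of a group $G$ is normal if $g^{-1}Xg = X$ for all $g \in G$ (equivalently, $X$ is a union of conjugacy classes of $G$). For a normal subset $X$ of $G$, the Cayley sum graph $\mathrm{CS}(G,X)$ is the graph with vertex set $G$ in which two vertices $g$ and $h$ are adjacent if and only if $gh \in X$ and $g \neq h$. A Cayley sum graph of $G$ is a graph $\mathrm{CS}(G,X)$ for some normal subset $X$ of $G$. A perfect code in a graph $\Gamma$ is a subset $C$ of the vertex set $V(\Gamma)$ such that no two vertices in $C$ are adjacent and every vertex in $V(\Gamma)\setminus C$ is adjacent to exactly one vertex in $C$. *)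

theory Defs
  imports "HOL-Algebra.Coset" "Graph_Theory.Pair_Digraph"
begin

definition normal_subset :: "('a, 'b) monoid_scheme \<Rightarrow> 'a set \<Rightarrow> bool" where
  "normal_subset G X \<longleftrightarrow>
     X \<subseteq> carrier G \<and> (\<forall>g \<in> carrier G. (inv\<^bsub>G\<^esub> g <#\<^bsub>G\<^esub> X) #>\<^bsub>G\<^esub> g = X)"

text \<open>Simple undirected graphs are represented as in \<^theory>\<open>Graph_Theory.Pair_Digraph\<close>:
  by a symmetric, irreflexive set of arcs on the vertex set.\<close>

definition cayley_sum_graph :: "('a, 'b) monoid_scheme \<Rightarrow> 'a set \<Rightarrow> 'a pair_pre_digraph" where
  "cayley_sum_graph G X =
     \<lparr>pverts = carrier G,
      parcs = {(g, h). g \<in> carrier G \<and> h \<in> carrier G \<and> g \<otimes>\<^bsub>G\<^esub> h \<in> X \<and> g \<noteq> h}\<rparr>"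

definition is_cayley_sum_graph_of :: "'a pair_pre_digraph \<Rightarrow> ('a, 'b) monoid_scheme \<Rightarrow> bool" where
  "is_cayley_sum_graph_of \<Gamma> G \<longleftrightarrow> (\<exists>X. normal_subset G X \<and> \<Gamma> = cayley_sum_graph G X)"

definition perfect_code :: "'a pair_pre_digraph \<Rightarrow> 'a set \<Rightarrow> bool" where
  "perfect_code \<Gamma> C \<longleftrightarrow>
     C \<subseteq> pverts \<Gamma> \<and>
     pairwise (\<lambda>c d. (c, d) \<notin> parcs \<Gamma>) C \<and>
     (\<forall>v \<in> pverts \<Gamma> - C. \<exists>!c. c \<in> C \<and> (v, c) \<in> parcs \<Gamma>)"

text \<open>Normality of \<open>X\<close> is what makes the adjacency relation symmetric, as \<open>h g = g\<inverse> (g h) g\<close>.\<close>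

lemma pair_graph_cayley_sum_graph:
  fixes G (structure)
  assumes "group G" and fin: "finite (carrier G)" and X: "normal_subset G X"
  shows "pair_graph (cayley_sum_graph G X)"
proof -
  interpret group G by fact
  let ?A = "parcs (cayley_sum_graph G X)"
  have sub: "?A \<subseteq> carrier G \<times> carrier G"
    by (auto simp: cayley_sum_graph_def)
  have "(h, g) \<in> ?A" if "(g, h) \<in> ?A" for g h
  proof -
    have gh: "g \<in> carrier G" "h \<in> carrier G" "g \<otimes> h \<in> X" "g \<noteq> h"
      using that by (auto simp: cayley_sum_graph_def)
    have "(inv g \<otimes> (g \<otimes> h)) \<otimes> g \<in> (inv g <# X) #> g"
      using gh(3) by (auto simp: l_coset_def r_coset_def)
    also have "(inv g <# X) #> g = X"
      using X gh(1) by (simp add: normal_subset_def)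
    also have "(inv g \<otimes> (g \<otimes> h)) \<otimes> g = h \<otimes> g"
      using gh by (simp add: m_assoc[symmetric])
    finally show ?thesis
      using gh by (simp add: cayley_sum_graph_def)
  qed
  then have "sym ?A"
    by (rule symI)
  moreover have "finite ?A"
    using sub fin by (meson finite_SigmaI finite_subset)
  ultimately show ?thesis
    using fin sub
    by unfold_locales (auto simp: cayley_sum_graph_def symmetric_def arcs_ends_def arc_to_ends_def)
qed

end

theory Submission
  imports Defs
begin

text \<open>
  Whether a subgroup \<open>H\<close> is a perfect code of \<open>CS(G, X)\<close> is a question about the left cosets of \<open>H\<close>:
  for \<open>v \<notin> H\<close> the map \<open>c \<mapsto> vc\<close> is a bijection from the neighbours of \<open>v\<close> in \<open>H\<close> to \<open>X \<inter> vH\<close>, and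
  two elements of \<open>H\<close> have their product in \<open>H\<close>, so edges inside \<open>H\<close> come from \<open>X \<inter> H\<close>. If the code
  is perfect then \<open>X \<inter> H \<subseteq> {1}\<close>, and the element \<open>1\<close> can be discarded from \<open>X\<close>. Hence \<open>H\<close> is a
  perfect code of some Cayley sum graph if and only if some normal subset of \<open>G\<close> misses \<open>H\<close> and
  meets every other left coset of \<open>H\<close> exactly once (\<open>perfect_code_iff_normal_transversal\<close>).

  Such transversals are easily moved along the quotient map \<open>\<pi> : G \<rightarrow> G/N\<close>, because \<open>N \<le> H\<close> makes
  \<open>\<pi>\<close> match the cosets of \<open>H\<close> with those of \<open>H/N\<close>. Downwards, take the image of the transversal.
  Upwards, let \<open>Y\<close> be a transversal for \<open>N\<close> and \<open>Z\<close> one for \<open>H/N\<close>. In a coset \<open>vH \<noteq> H\<close> the set \<open>Z\<close>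
  selects one coset of \<open>N\<close>, which is not \<open>N\<close> itself, and in that coset \<open>Y\<close> selects one element; so
  \<open>Y \<inter> \<pi>\<^sup>-\<^sup>1(Z)\<close> is a transversal for \<open>H\<close>.
\<close>

section \<open>Perfect codes as normal transversals\<close>

definition normal_transversal :: "('a, 'b) monoid_scheme \<Rightarrow> 'a set \<Rightarrow> 'a set \<Rightarrow> bool" where
  "normal_transversal G H X \<longleftrightarrow>
     normal_subset G X \<and> X \<inter> H = {} \<and>
     (\<forall>v \<in> carrier G - H. \<exists>!x. x \<in> X \<and> x \<in> v <#\<^bsub>G\<^esub> H)"

lemma normal_transversal_repE:
  assumes "normal_transversal G H X" "v \<in> carrier G - H"
  obtains x where "x \<in> X" "x \<in> v <#\<^bsub>G\<^esub> H"
    and "\<And>y. y \<in> X \<Longrightarrow> y \<in> v <#\<^bsub>G\<^esub> H \<Longrightarrow> y = x"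
proof -
  have "\<exists>!x. x \<in> X \<and> x \<in> v <#\<^bsub>G\<^esub> H"
    using assms by (simp add: normal_transversal_def)
  then show ?thesis
    using that by (elim ex1E) blast
qed

context group
begin

lemma normal_subset_iff_conj_closed:
  "normal_subset G X \<longleftrightarrow>
     X \<subseteq> carrier G \<and> (\<forall>g \<in> carrier G. \<forall>x \<in> X. inv g \<otimes> x \<otimes> g \<in> X)" (is "?L \<longleftrightarrow> ?R")
proof
  assume L: ?L
  have "inv g \<otimes> x \<otimes> g \<in> X" if "g \<in> carrier G" "x \<in> X" for g x
  proof -
    have "inv g \<otimes> x \<otimes> g \<in> (inv g <# X) #> g"
      using that by (auto simp: l_coset_def r_coset_def)
    then show ?thesis
      using L that by (simp add: normal_subset_def)
  qed
  then show ?R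
    using L by (simp add: normal_subset_def)
next
  assume R: ?R
  have "(inv g <# X) #> g = X" if g: "g \<in> carrier G" for g
  proof
    show "(inv g <# X) #> g \<subseteq> X"
      using R g by (auto simp: l_coset_def r_coset_def)
    show "X \<subseteq> (inv g <# X) #> g"
    proof
      fix x assume x: "x \<in> X"
      then have xc: "x \<in> carrier G"
        using R by blast
      have "inv (inv g) \<otimes> x \<otimes> inv g \<in> X"
        using R g x by blast
      then have mem: "g \<otimes> x \<otimes> inv g \<in> X"
        using g by simp
      have "x = inv g \<otimes> (g \<otimes> x \<otimes> inv g) \<otimes> g"
        using g xc by (simp add: m_assoc[symmetric]) (simp add: m_assoc)
      with mem show "x \<in> (inv g <# X) #> g"
        unfolding l_coset_def r_coset_def by blast
    qed
  qed
  then show ?L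
    using R by (simp add: normal_subset_def)
qed

lemma mem_l_coset_iff:
  assumes "subgroup H G" "v \<in> carrier G" "x \<in> carrier G"
  shows "x \<in> v <# H \<longleftrightarrow> inv v \<otimes> x \<in> H"
proof
  assume "x \<in> v <# H"
  then obtain h where "h \<in> H" "x = v \<otimes> h"
    by (auto simp: l_coset_def)
  then show "inv v \<otimes> x \<in> H"
    using assms subgroup.mem_carrier[OF assms(1)] by (simp add: m_assoc[symmetric])
next
  assume "inv v \<otimes> x \<in> H"
  moreover have "x = v \<otimes> (inv v \<otimes> x)"
    using assms by (simp add: m_assoc[symmetric])
  ultimately show "x \<in> v <# H"
    unfolding l_coset_def by blast
qed

lemma l_coset_disjoint_subgroup:
  assumes H: "subgroup H G" and v: "v \<in> carrier G - H"
  shows "(v <# H) \<inter> H = {}"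
proof (rule ccontr)
  assume "(v <# H) \<inter> H \<noteq> {}"
  then obtain h where h: "h \<in> H" "v \<otimes> h \<in> H"
    by (auto simp: l_coset_def)
  then have "v \<otimes> h \<otimes> inv h \<in> H"
    using H by (simp add: subgroup.m_closed subgroup.m_inv_closed)
  then show False
    using v h subgroup.mem_carrier[OF H] by (simp add: m_assoc)
qed

text \<open>Neighbours of \<open>v \<notin> H\<close> inside \<open>H\<close> correspond to the elements of \<open>X \<inter> vH\<close> via \<open>c \<mapsto> vc\<close>; the
  condition \<open>v \<noteq> c\<close> of adjacency is automatic.\<close>

lemma ex1_neighbour_iff_ex1_in_l_coset:
  assumes H: "subgroup H G" and v: "v \<in> carrier G - H"
  shows "(\<exists>!c. c \<in> H \<and> (v, c) \<in> parcs (cayley_sum_graph G X)) \<longleftrightarrow>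
         (\<exists>!x. x \<in> X \<and> x \<in> v <# H)"
proof -
  have sub: "H \<subseteq> carrier G"
    using H by (rule subgroup.subset)
  have bij: "bij_betw (\<lambda>c. v \<otimes> c) {c \<in> H. v \<otimes> c \<in> X} {x \<in> X. x \<in> v <# H}"
    using v sub by (intro bij_betw_imageI inj_onI) (auto simp: l_coset_def subset_iff)
  have "(\<exists>!c. c \<in> H \<and> (v, c) \<in> parcs (cayley_sum_graph G X)) \<longleftrightarrow>
        (\<exists>!c. c \<in> H \<and> v \<otimes> c \<in> X)"
    using v sub by (intro arg_cong[where f = Ex1] ext) (auto simp: cayley_sum_graph_def)
  also have "\<dots> \<longleftrightarrow> is_singleton {c \<in> H. v \<otimes> c \<in> X}"
    by (simp add: is_singleton_def set_eq_iff Ex1_def) blast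
  also have "\<dots> \<longleftrightarrow> is_singleton {x \<in> X. x \<in> v <# H}"
    using bij_betw_same_card[OF bij] by (simp add: is_singleton_altdef)
  also have "\<dots> \<longleftrightarrow> (\<exists>!x. x \<in> X \<and> x \<in> v <# H)"
    by (simp add: is_singleton_def set_eq_iff Ex1_def) blast
  finally show ?thesis .
qed

lemma perfect_code_iff_normal_transversal:
  assumes H: "subgroup H G"
  shows "(\<exists>\<Gamma>. is_cayley_sum_graph_of \<Gamma> G \<and> perfect_code \<Gamma> H) \<longleftrightarrow>
         (\<exists>X. normal_transversal G H X)"
proof
  assume "\<exists>\<Gamma>. is_cayley_sum_graph_of \<Gamma> G \<and> perfect_code \<Gamma> H"
  then obtain X where X: "normal_subset G X" and code: "perfect_code (cayley_sum_graph G X) H"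
    by (auto simp: is_cayley_sum_graph_of_def)
  have "x = \<one>" if x: "x \<in> X" "x \<in> H" for x
  proof (rule ccontr)
    \<comment> \<open>Otherwise \<open>1\<close> and \<open>x\<close> are distinct elements of \<open>H\<close> whose product \<open>x\<close> lies in \<open>X\<close>.\<close>
    assume "x \<noteq> \<one>"
    then have "(\<one>, x) \<in> parcs (cayley_sum_graph G X)"
      using x subgroup.mem_carrier[OF H] by (auto simp: cayley_sum_graph_def)
    moreover have "\<one> \<in> H"
      using H by (rule subgroup.one_closed)
    ultimately show False
      using code x \<open>x \<noteq> \<one>\<close> by (auto simp: perfect_code_def pairwise_def)
  qed
  then have disj: "(X - {\<one>}) \<inter> H = {}"
    by blast
  have "inv g \<otimes> x \<otimes> g \<noteq> \<one>" if "g \<in> carrier G" "x \<in> carrier G" "x \<noteq> \<one>" for g x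
  proof
    assume "inv g \<otimes> x \<otimes> g = \<one>"
    then have "g \<otimes> (inv g \<otimes> x \<otimes> g) \<otimes> inv g = \<one>"
      using that by simp
    then show False
      using that by (simp add: m_assoc[symmetric]) (simp add: m_assoc)
  qed
  then have "normal_subset G (X - {\<one>})"
    using X by (auto simp: normal_subset_iff_conj_closed)
  moreover have "\<exists>!x. x \<in> X - {\<one>} \<and> x \<in> v <# H" if v: "v \<in> carrier G - H" for v
  proof -
    have "\<one> \<notin> v <# H"
      using l_coset_disjoint_subgroup[OF H v] subgroup.one_closed[OF H] by blast
    then have "x \<in> X - {\<one>} \<and> x \<in> v <# H \<longleftrightarrow> x \<in> X \<and> x \<in> v <# H" for x
      by blast
    moreover have "\<exists>!x. x \<in> X \<and> x \<in> v <# H"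
      using code v unfolding ex1_neighbour_iff_ex1_in_l_coset[OF H v, symmetric]
      by (auto simp: perfect_code_def cayley_sum_graph_def)
    ultimately show ?thesis
      by simp
  qed
  ultimately show "\<exists>X. normal_transversal G H X"
    using disj unfolding normal_transversal_def by blast
next
  assume "\<exists>X. normal_transversal G H X"
  then obtain X where X: "normal_subset G X" and disj: "X \<inter> H = {}"
    and ex1: "\<And>v. v \<in> carrier G - H \<Longrightarrow> \<exists>!x. x \<in> X \<and> x \<in> v <# H"
    by (auto simp: normal_transversal_def)
  have "pairwise (\<lambda>c d. (c, d) \<notin> parcs (cayley_sum_graph G X)) H"
    using disj subgroup.m_closed[OF H] by (auto simp: pairwise_def cayley_sum_graph_def)
  moreover have "\<exists>!c. c \<in> H \<and> (v, c) \<in> parcs (cayley_sum_graph G X)" if "v \<in> carrier G - H" for v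
    using ex1_neighbour_iff_ex1_in_l_coset[OF H that] ex1[OF that] by simp
  ultimately have "perfect_code (cayley_sum_graph G X) H"
    using subgroup.subset[OF H] by (simp add: perfect_code_def cayley_sum_graph_def)
  then show "\<exists>\<Gamma>. is_cayley_sum_graph_of \<Gamma> G \<and> perfect_code \<Gamma> H"
    using X unfolding is_cayley_sum_graph_of_def by blast
qed

end

context group_hom
begin

section \<open>Normal transversals and homomorphisms\<close>

lemma hom_mem_image_iff:
  assumes K: "subgroup K G" and ker: "kernel G H h \<subseteq> K" and x: "x \<in> carrier G"
  shows "h x \<in> h ` K \<longleftrightarrow> x \<in> K"
proof
  assume "h x \<in> h ` K"
  then obtain k where k: "k \<in> K" "h x = h k"
    by blast
  have kc: "k \<in> carrier G"
    using K k(1) by (rule subgroup.mem_carrier)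
  have "x \<otimes> inv k \<in> kernel G H h"
    using k x kc by (simp add: kernel_def)
  then have "x \<otimes> inv k \<otimes> k \<in> K"
    using ker k(1) by (blast intro: subgroup.m_closed[OF K])
  then show "x \<in> K"
    using x kc by (simp add: G.m_assoc)
qed simp

text \<open>The matching of cosets that makes transversals move in both directions. It holds since
  \<open>h(v\<^sup>-\<^sup>1x) \<in> h(K)\<close> forces \<open>v\<^sup>-\<^sup>1x \<in> K\<close>, as \<open>K\<close> absorbs the kernel.\<close>

lemma hom_mem_l_coset_iff:
  assumes K: "subgroup K G" and ker: "kernel G H h \<subseteq> K"
    and v: "v \<in> carrier G" and x: "x \<in> carrier G"
  shows "h x \<in> h v <#\<^bsub>H\<^esub> (h ` K) \<longleftrightarrow> x \<in> v <# K"
proof -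
  have "h x \<in> h v <#\<^bsub>H\<^esub> (h ` K) \<longleftrightarrow> h (inv v \<otimes> x) \<in> h ` K"
    using v x subgroup_img_is_subgroup[OF K] by (simp add: H.mem_l_coset_iff)
  also have "\<dots> \<longleftrightarrow> x \<in> v <# K"
    using v x hom_mem_image_iff[OF K ker, of "inv v \<otimes> x"] by (simp add: G.mem_l_coset_iff[OF K])
  finally show ?thesis .
qed

lemma normal_transversal_image:
  assumes surj: "h ` carrier G = carrier H"
    and K: "subgroup K G" and ker: "kernel G H h \<subseteq> K"
    and X: "normal_transversal G K X"
  shows "normal_transversal H (h ` K) (h ` X)"
  unfolding normal_transversal_def
proof (intro conjI ballI)
  have Xc: "X \<subseteq> carrier G" and conj: "\<And>g x. g \<in> carrier G \<Longrightarrow> x \<in> X \<Longrightarrow> inv g \<otimes> x \<otimes> g \<in> X"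
    using X by (auto simp: normal_transversal_def G.normal_subset_iff_conj_closed)
  show "normal_subset H (h ` X)"
    unfolding H.normal_subset_iff_conj_closed
  proof (intro conjI ballI)
    show "h ` X \<subseteq> carrier H"
      using Xc by auto
    fix q y assume "q \<in> carrier H" "y \<in> h ` X"
    then obtain g x where gx: "g \<in> carrier G" "q = h g" "x \<in> X" "y = h x"
      unfolding surj[symmetric] by blast
    then have "inv\<^bsub>H\<^esub> q \<otimes>\<^bsub>H\<^esub> y \<otimes>\<^bsub>H\<^esub> q = h (inv g \<otimes> x \<otimes> g)"
      using Xc by (auto simp: subset_iff)
    then show "inv\<^bsub>H\<^esub> q \<otimes>\<^bsub>H\<^esub> y \<otimes>\<^bsub>H\<^esub> q \<in> h ` X"
      using conj gx by blast
  qed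
  show "h ` X \<inter> h ` K = {}"
  proof -
    have "h x \<notin> h ` K" if "x \<in> X" for x
      using that X Xc hom_mem_image_iff[OF K ker, of x] by (auto simp: normal_transversal_def)
    then show ?thesis
      by blast
  qed
  fix q assume "q \<in> carrier H - h ` K"
  then obtain v where v: "v \<in> carrier G - K" "q = h v"
    unfolding surj[symmetric] by blast
  then obtain x where x: "x \<in> X" "x \<in> v <# K"
    and uniq: "\<And>y. y \<in> X \<Longrightarrow> y \<in> v <# K \<Longrightarrow> y = x"
    using normal_transversal_repE[OF X] by metis
  have "h y \<in> q <#\<^bsub>H\<^esub> (h ` K) \<longleftrightarrow> y \<in> v <# K" if "y \<in> X" for y
    using that v Xc hom_mem_l_coset_iff[OF K ker] by blast
  with x uniq show "\<exists>!y. y \<in> h ` X \<and> y \<in> q <#\<^bsub>H\<^esub> (h ` K)"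
    by blast
qed

text \<open>The selection happens in two stages: \<open>Z\<close> picks one fibre of \<open>h\<close> inside \<open>vK\<close>, then \<open>Y\<close> picks one
  element of that fibre. The second stage works because the fibre avoids \<open>K\<close> and so is not the
  kernel, the one coset of the kernel that \<open>Y\<close> misses.\<close>

lemma normal_transversal_lift:
  assumes surj: "h ` carrier G = carrier H"
    and K: "subgroup K G" and ker: "kernel G H h \<subseteq> K"
    and Y: "normal_transversal G (kernel G H h) Y"
    and Z: "normal_transversal H (h ` K) Z"
  shows "normal_transversal G K {y \<in> Y. h y \<in> Z}"
  unfolding normal_transversal_def
proof (intro conjI ballI)
  have Yc: "Y \<subseteq> carrier G" and Zc: "Z \<subseteq> carrier H"
    using Y Z by (auto simp: normal_transversal_def normal_subset_def)
  show "normal_subset G {y \<in> Y. h y \<in> Z}"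
    using Y Z
    by (auto simp: normal_transversal_def G.normal_subset_iff_conj_closed
        H.normal_subset_iff_conj_closed subset_iff)
  show "{y \<in> Y. h y \<in> Z} \<inter> K = {}"
    using Z by (auto simp: normal_transversal_def)
  fix v assume v: "v \<in> carrier G - K"
  then have "h v \<in> carrier H - h ` K"
    by (simp add: hom_mem_image_iff[OF K ker])
  then obtain z where z: "z \<in> Z" "z \<in> h v <#\<^bsub>H\<^esub> (h ` K)"
    and z_uniq: "\<And>z'. z' \<in> Z \<Longrightarrow> z' \<in> h v <#\<^bsub>H\<^esub> (h ` K) \<Longrightarrow> z' = z"
    using normal_transversal_repE[OF Z] by metis
  obtain w where w: "w \<in> carrier G" "z = h w"
    using z(1) Zc surj by blast
  have wv: "w \<in> v <# K"
    using z(2) w v by (simp add: hom_mem_l_coset_iff[OF K ker])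
  have "w \<notin> kernel G H h"
    using G.l_coset_disjoint_subgroup[OF K v] wv ker by blast
  then obtain y where y: "y \<in> Y" "y \<in> w <# kernel G H h"
    and y_uniq: "\<And>y'. y' \<in> Y \<Longrightarrow> y' \<in> w <# kernel G H h \<Longrightarrow> y' = y"
    using normal_transversal_repE[OF Y, of w] w(1) by (metis DiffI)
  have fibre: "u \<in> w <# kernel G H h \<longleftrightarrow> h u = z" if "u \<in> carrier G" for u
  proof -
    have "u \<in> w <# kernel G H h \<longleftrightarrow> inv\<^bsub>H\<^esub> (h w) \<otimes>\<^bsub>H\<^esub> h u = \<one>\<^bsub>H\<^esub>"
      using that w(1) by (simp add: G.mem_l_coset_iff[OF subgroup_kernel]) (simp add: kernel_def)
    also have "\<dots> \<longleftrightarrow> h u = z"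
      using that w by (simp add: H.inv_solve_left')
    finally show ?thesis .
  qed
  show "\<exists>!x. x \<in> {y \<in> Y. h y \<in> Z} \<and> x \<in> v <# K"
  proof (rule ex1I[of _ y])
    have hy: "h y = z"
      using y Yc fibre by blast
    then show "y \<in> {y \<in> Y. h y \<in> Z} \<and> y \<in> v <# K"
      using y(1) Yc z v by (auto simp: hom_mem_l_coset_iff[OF K ker, symmetric])
    fix x assume x: "x \<in> {y \<in> Y. h y \<in> Z} \<and> x \<in> v <# K"
    then have xc: "x \<in> carrier G"
      using Yc by blast
    then have "h x = z"
      using x v z_uniq by (simp add: hom_mem_l_coset_iff[OF K ker])
    then show "x = y"
      using x xc fibre y_uniq by blast
  qed
qed

end

section \<open>Passing to the quotient and back\<close>

theorem theorem8:
  fixes G :: "('a, 'b) monoid_scheme" and N H :: "'a set"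
  assumes "group G" and "finite (carrier G)"
    and "N \<lhd> G" and "H \<lhd> G" and "N \<subseteq> H"
  shows "((\<exists>\<Gamma>. is_cayley_sum_graph_of \<Gamma> G \<and> perfect_code \<Gamma> H) \<longrightarrow>
          (\<exists>\<Gamma>. is_cayley_sum_graph_of \<Gamma> (G Mod N) \<and>
               perfect_code \<Gamma> (carrier ((G\<lparr>carrier := H\<rparr>) Mod N)))) \<and>
         ((\<exists>\<Gamma>. is_cayley_sum_graph_of \<Gamma> G \<and> perfect_code \<Gamma> N) \<and>
          (\<exists>\<Gamma>. is_cayley_sum_graph_of \<Gamma> (G Mod N) \<and>
               perfect_code \<Gamma> (carrier ((G\<lparr>carrier := H\<rparr>) Mod N))) \<longrightarrow>
          (\<exists>\<Gamma>. is_cayley_sum_graph_of \<Gamma> G \<and> perfect_code \<Gamma> H))"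
proof -
  let ?\<pi> = "\<lambda>g. N #>\<^bsub>G\<^esub> g"
  interpret N: normal N G by fact
  interpret Q: group "G Mod N" by (rule N.factorgroup_is_group)
  interpret \<pi>: group_hom G "G Mod N" ?\<pi>
    by unfold_locales (rule N.r_coset_hom_Mod)
  have H: "subgroup H G"
    using \<open>H \<lhd> G\<close> by (rule normal_imp_subgroup)
  have surj: "?\<pi> ` carrier G = carrier (G Mod N)"
    by (auto simp: FactGroup_def RCOSETS_def)
  have ker: "kernel G (G Mod N) ?\<pi> = N"
    using N.subset N.coset_join1 N.rcos_const N.is_subgroup
    by (auto simp: kernel_def FactGroup_def)
  have img: "carrier ((G\<lparr>carrier := H\<rparr>) Mod N) = ?\<pi> ` H"
    by (auto simp: FactGroup_def RCOSETS_def r_coset_def)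
  note code_iffs = N.perfect_code_iff_normal_transversal[OF H]
    N.perfect_code_iff_normal_transversal[OF N.is_subgroup]
    Q.perfect_code_iff_normal_transversal[OF \<pi>.subgroup_img_is_subgroup[OF H]]
  show ?thesis
    unfolding img code_iffs
    using \<pi>.normal_transversal_image[OF surj H] \<pi>.normal_transversal_lift[OF surj H]
      \<open>N \<subseteq> H\<close>
    unfolding ker by blast
qed

end
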